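(* Let $G$ be an infinite countable discrete Abelian group with a F\o lner sequence $\mathbf{F}$. Then a $G$-system $(X,G)$ is weakly mixing if and only if it has uniform positive sequence entropy (u.p.s.e.).
   Context: The F\o lner sequence $\mathbf{F}=\{F_n\}_{n=1}^\infty$ is a sequence of finite subsets of $G$ with $\lim_{n\to\infty}|gF_n\triangle F_n|/|F_n|=0$ for every $g\in G$, $e_G\in F_1\subseteq F_2\subseteq\cdots$ and $\bigcup_n F_n=G$. A $G$-system $(X,G)$ is a compact metric space $X$ with a continuous action of $G$. It is (topologically) weakly mixing if for any four nonempty open sets $U_1,U_2,V_1,V_2\subset X$ there exists $g\in G$ with $U_1\cap g^{-1}V_1\neq\emptyset$ and $U_2\cap g^{-1}V_2\neq\emptyset$. For a finite open cover $\mathcal{U}$ of $X$, $\mathcal{N}(\mathcal{U})$ is the minimal cardinality of a subcover, $g^{-1}\mathcal{U}=\{g^{-1}U:U\in\mathcal{U}\}$, and $\bigvee$ denotes the common refinement. For an infinite subset $S\subset G$, $$h_{\mathrm{top}}^{S,\mathbf{F}}(G,\mathcal{U})=\limsup_{n\to\infty}\frac{1}{|S\cap F_n|}\log\mathcal{N}\Big(\bigvee_{g\in S\cap F_n}g^{-1}\mathcal{U}\Big).$$ A pair $(x_1,x_2)\in X\times X$ is a sequence entropy pair if $x_1\neq x_2$ and, whenever $U_1,U_2$ are disjoint closed neighborhoods of $x_1,x_2$ respectively, there exists an infinite subset $S\subset G$ such that $h_{\mathrm{top}}^{S,\mathbf{F}}(G,\{X\setminus U_1,X\setminus U_2\})>0$.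 The system $(X,G)$ has uniform positive sequence entropy (u.p.s.e.) if every $(x_1,x_2)\in X\times X$ with $x_1\neq x_2$ is a sequence entropy pair. *)

theory Defs
  imports "HOL-Analysis.Analysis" "HOL-Algebra.Group_Action"
begin

text \<open>
  Groups are \<open>HOL-Algebra\<close> groups. A compact metric space is a compact subset \<open>X\<close> of a
  metric space, carrying the subspace topology \<open>top_of_set X\<close>; all topological notions
  below are relative to it. An action is a homomorphism \<open>\<phi>\<close> from \<open>G\<close> to the bijections of
  \<open>X\<close>, so that \<open>\<phi> g x\<close> is the point usually written \<open>gx\<close>.
\<close>

text \<open>The sequence is indexed from 0, so \<open>F n\<close> plays the role of the customary \<open>F\<^sub>n\<^sub>+\<^sub>1\<close>.\<close>

definition Folner_sequence :: "('g, 'b) monoid_scheme \<Rightarrow> (nat \<Rightarrow> 'g set) \<Rightarrow> bool" where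
  "Folner_sequence G F \<longleftrightarrow>
     (\<forall>n. finite (F n) \<and> F n \<subseteq> carrier G) \<and>
     (\<forall>g \<in> carrier G.
        (\<lambda>n. real (card (sym_diff (g <#\<^bsub>G\<^esub> F n) (F n))) / real (card (F n))) \<longlonglongrightarrow> 0) \<and>
     \<one>\<^bsub>G\<^esub> \<in> F 0 \<and> incseq F \<and> (\<Union>n. F n) = carrier G"

text \<open>Since \<open>G\<close> is discrete, continuity of the action means continuity of each \<open>\<phi> g\<close>.\<close>

definition G_system ::
  "('g, 'b) monoid_scheme \<Rightarrow> 'x::metric_space set \<Rightarrow> ('g \<Rightarrow> 'x \<Rightarrow> 'x) \<Rightarrow> bool" where
  "G_system G X \<phi> \<longleftrightarrow>
     compact X \<and> group_action G X \<phi> \<and> (\<forall>g \<in> carrier G. continuous_on X (\<phi> g))"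

definition weakly_mixing ::
  "('g, 'b) monoid_scheme \<Rightarrow> 'x::topological_space set \<Rightarrow> ('g \<Rightarrow> 'x \<Rightarrow> 'x) \<Rightarrow> bool" where
  "weakly_mixing G X \<phi> \<longleftrightarrow>
     (\<forall>U1 U2 V1 V2.
        openin (top_of_set X) U1 \<and> U1 \<noteq> {} \<and> openin (top_of_set X) U2 \<and> U2 \<noteq> {} \<and>
        openin (top_of_set X) V1 \<and> V1 \<noteq> {} \<and> openin (top_of_set X) V2 \<and> V2 \<noteq> {} \<longrightarrow>
        (\<exists>g \<in> carrier G. U1 \<inter> \<phi> (inv\<^bsub>G\<^esub> g) ` V1 \<noteq> {} \<and> U2 \<inter> \<phi> (inv\<^bsub>G\<^esub> g) ` V2 \<noteq> {}))"

definition subcover_number :: "'x set \<Rightarrow> 'x set set \<Rightarrow> nat" where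
  "subcover_number X \<U> = (LEAST k. \<exists>\<V>. \<V> \<subseteq> \<U> \<and> finite \<V> \<and> \<Union>\<V> = X \<and> card \<V> = k)"

text \<open>The common refinement of the covers \<open>\<W> i\<close>; for \<open>I = {}\<close> it is the trivial cover \<open>{X}\<close>.\<close>

definition common_refinement :: "'x set \<Rightarrow> 'i set \<Rightarrow> ('i \<Rightarrow> 'x set set) \<Rightarrow> 'x set set" where
  "common_refinement X I \<W> = {X \<inter> (\<Inter>i\<in>I. c i) | c. c \<in> Pi I \<W>}"

definition translated_cover ::
  "('g, 'b) monoid_scheme \<Rightarrow> ('g \<Rightarrow> 'x \<Rightarrow> 'x) \<Rightarrow> 'x set set \<Rightarrow> 'g \<Rightarrow> 'x set set" where
  "translated_cover G \<phi> \<U> g = (\<lambda>U. \<phi> (inv\<^bsub>G\<^esub> g) ` U) ` \<U>"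

text \<open>
  Intended for infinite \<open>S\<close>. Then \<open>S \<inter> F n\<close> is empty for finitely many \<open>n\<close> only, and the
  convention \<open>t / 0 = 0\<close> at these \<open>n\<close> does not affect the limit superior.
\<close>

definition sequence_entropy ::
  "('g, 'b) monoid_scheme \<Rightarrow> 'x set \<Rightarrow> ('g \<Rightarrow> 'x \<Rightarrow> 'x) \<Rightarrow> (nat \<Rightarrow> 'g set) \<Rightarrow> 'g set
     \<Rightarrow> 'x set set \<Rightarrow> ereal" where
  "sequence_entropy G X \<phi> F S \<U> =
     limsup (\<lambda>n. ereal (1 / real (card (S \<inter> F n)) *
       ln (real (subcover_number X (common_refinement X (S \<inter> F n) (translated_cover G \<phi> \<U>))))))"

definition closed_neighborhood :: "'x::topological_space set \<Rightarrow> 'x \<Rightarrow> 'x set \<Rightarrow> bool" where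
  "closed_neighborhood X x U \<longleftrightarrow>
     closedin (top_of_set X) U \<and> x \<in> (top_of_set X) interior_of U"

definition sequence_entropy_pair ::
  "('g, 'b) monoid_scheme \<Rightarrow> 'x::topological_space set \<Rightarrow> ('g \<Rightarrow> 'x \<Rightarrow> 'x) \<Rightarrow> (nat \<Rightarrow> 'g set)
     \<Rightarrow> 'x \<Rightarrow> 'x \<Rightarrow> bool" where
  "sequence_entropy_pair G X \<phi> F x1 x2 \<longleftrightarrow>
     x1 \<in> X \<and> x2 \<in> X \<and> x1 \<noteq> x2 \<and>
     (\<forall>U1 U2. closed_neighborhood X x1 U1 \<and> closed_neighborhood X x2 U2 \<and> U1 \<inter> U2 = {} \<longrightarrow>
        (\<exists>S. S \<subseteq> carrier G \<and> infinite S \<and> sequence_entropy G X \<phi> F S {X - U1, X - U2} > 0))"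

definition uniform_positive_sequence_entropy ::
  "('g, 'b) monoid_scheme \<Rightarrow> 'x::topological_space set \<Rightarrow> ('g \<Rightarrow> 'x \<Rightarrow> 'x) \<Rightarrow> (nat \<Rightarrow> 'g set)
     \<Rightarrow> bool" where
  "uniform_positive_sequence_entropy G X \<phi> F \<longleftrightarrow>
     (\<forall>x1 \<in> X. \<forall>x2 \<in> X. x1 \<noteq> x2 \<longrightarrow> sequence_entropy_pair G X \<phi> F x1 x2)"

end

theory Submission
  imports Defs "HOL-Real_Asymp.Real_Asymp"
begin

text \<open>
  For nonempty relatively open sets, write \<open>N(U, V)\<close> for the set of all \<open>g\<close> with
  \<open>gU \<inter> V \<noteq> {}\<close>.

  If the system is weakly mixing, then by Furstenberg's intersection lemma finitely many sets
  \<open>N(U, V)\<close> always have a common element, so one can choose \<open>g\<^sub>1, g\<^sub>2, \<dots>\<close> one after the other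
  such that every pattern of visits to two disjoint neighbourhoods is realised along every
  finite part of the sequence. Each cell of the refined cover then contains only one of the
  \<open>2\<^sup>n\<close> patterns.

  Conversely, a visit pattern is a partial function to \<open>bool\<close>. If no pair of group elements is
  shattered by these partial functions, an argument of Sauer-Shelah type bounds the covering
  number along \<open>n\<close> elements by \<open>(n + 1)\<^sup>k (1 + 2\<^sup>-\<^sup>k)\<^sup>n\<close> for each \<open>k\<close>, so all sequence entropies
  vanish. Hence positive entropy yields a shattered pair \<open>g \<noteq> h\<close>, and then \<open>hg\<^sup>-\<^sup>1\<close> lies in
  \<open>N(U, U) \<inter> N(U, V)\<close>. Since the group is commutative, nonemptiness of all these
  intersections implies weak mixing.
\<close>

section \<open>Shattering by partial functions\<close>

text \<open>Vapnik-Chervonenkis shattering for partial functions: \<open>None\<close> agrees with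
  neither value. The empty set is shattered exactly when \<open>A\<close> is nonempty.\<close>

definition shattered :: "('a \<Rightarrow> 't \<Rightarrow> bool option) \<Rightarrow> 'a set \<Rightarrow> 't set \<Rightarrow> bool" where
  "shattered f A W \<longleftrightarrow> (\<forall>B\<subseteq>W. \<exists>x\<in>A. \<forall>t\<in>W. f x t = Some (t \<in> B))"

definition shattered_subsets :: "('a \<Rightarrow> 't \<Rightarrow> bool option) \<Rightarrow> 'a set \<Rightarrow> 't set \<Rightarrow> 't set set" where
  "shattered_subsets f A T = {W. W \<subseteq> T \<and> shattered f A W}"

lemma shattered_mono: "shattered f A W \<Longrightarrow> A \<subseteq> A' \<Longrightarrow> shattered f A' W"
  unfolding shattered_def by blast

lemma shattered_subset:
  assumes "shattered f A W" "W' \<subseteq> W"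
  shows "shattered f A W'"
  unfolding shattered_def
proof (intro allI impI)
  fix B assume "B \<subseteq> W'"
  then have "B \<subseteq> W" using assms(2) by blast
  then show "\<exists>x\<in>A. \<forall>t\<in>W'. f x t = Some (t \<in> B)"
    using assms unfolding shattered_def by (meson subsetD)
qed

lemma finite_shattered_subsets: "finite T \<Longrightarrow> finite (shattered_subsets f A T)"
  unfolding shattered_subsets_def by simp

lemma shattered_subsets_mono:
  "A \<subseteq> A' \<Longrightarrow> T \<subseteq> T' \<Longrightarrow> shattered_subsets f A T \<subseteq> shattered_subsets f A' T'"
  unfolding shattered_subsets_def using shattered_mono by blast

text \<open>A set shattered by both halves remains shattered when \<open>t\<close> is added to it.\<close>

lemma card_shattered_subsets_split:
  fixes f :: "'a \<Rightarrow> 't \<Rightarrow> bool option"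
  assumes "finite T" "t \<notin> T"
  shows "card (shattered_subsets f {x \<in> A. f x t = Some True} T) +
         card (shattered_subsets f {x \<in> A. f x t = Some False} T)
         \<le> card (shattered_subsets f A (insert t T))"
    (is "card ?P + card ?Q \<le> card ?R")
proof -
  have fin: "finite ?P" "finite ?Q" "finite ?R"
    using assms by (simp_all add: finite_shattered_subsets)
  have sub: "?P \<union> ?Q \<subseteq> ?R"
    using shattered_subsets_mono[of "{x \<in> A. f x t = Some True}" A T "insert t T" f]
      shattered_subsets_mono[of "{x \<in> A. f x t = Some False}" A T "insert t T" f] by blast
  have notin: "t \<notin> W" if "W \<in> ?P \<union> ?Q" for W
    using that assms(2) unfolding shattered_subsets_def by blast
  have both: "insert t W \<in> ?R" if W: "W \<in> ?P \<inter> ?Q" for W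
  proof -
    have "W \<subseteq> T" and sP: "shattered f {x \<in> A. f x t = Some True} W"
      and sQ: "shattered f {x \<in> A. f x t = Some False} W"
      using W unfolding shattered_subsets_def by auto
    have "\<exists>x\<in>A. \<forall>s\<in>insert t W. f x s = Some (s \<in> B)" for B
    proof -
      have tW: "t \<notin> W" using notin W by blast
      have "\<exists>x\<in>A. f x t = Some (t \<in> B) \<and> (\<forall>s\<in>W. f x s = Some (s \<in> B \<inter> W))"
      proof (cases "t \<in> B")
        case True
        then show ?thesis using sP[unfolded shattered_def, rule_format, of "B \<inter> W"] by auto
      next
        case False
        then show ?thesis using sQ[unfolded shattered_def, rule_format, of "B \<inter> W"] by auto
      qed
      then show ?thesis by auto
    qed
    with \<open>W \<subseteq> T\<close> show ?thesis unfolding shattered_subsets_def shattered_def by auto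
  qed
  have inj: "inj_on (insert t) (?P \<inter> ?Q)"
    using notin by (intro inj_onI) (simp add: insert_ident)
  \<comment> \<open>A set counted in both halves is charged the second time to
    \<open>insert t W\<close>. These new sets contain \<open>t\<close>, so they differ from all
    members of \<open>?P\<close> and \<open>?Q\<close>.\<close>
  have "card ?P + card ?Q = card (?P \<union> ?Q) + card (?P \<inter> ?Q)"
    using fin by (intro card_Un_Int)
  also have "\<dots> = card (?P \<union> ?Q) + card (insert t ` (?P \<inter> ?Q))"
    using card_image[OF inj] by simp
  also have "\<dots> = card ((?P \<union> ?Q) \<union> insert t ` (?P \<inter> ?Q))"
    using fin notin by (subst card_Un_disjoint) auto
  also have "\<dots> \<le> card ?R"
    using fin sub both by (intro card_mono) auto
  finally show ?thesis .
qed

text \<open>The total functions in \<open>C\<close> extend the restrictions of all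
  \<open>f x\<close> to \<open>T\<close>. Each new coordinate splits \<open>A\<close>, and one part
  has at most half of the shattered sets, so its \<open>k\<close>-th power bound shrinks by
  \<open>2^k\<close>. This yields the factor \<open>1 + 1 / 2 ^ k\<close>. A large \<open>k\<close>
  lowers the exponential rate at the price of a higher power of the number of shattered
  sets.\<close>

lemma partial_functions_cover:
  fixes f :: "'a \<Rightarrow> 't \<Rightarrow> bool option"
  assumes "finite T"
  shows "\<exists>C. finite C \<and> (\<forall>x\<in>A. \<exists>c\<in>C. \<forall>t\<in>T. f x t \<noteq> Some (\<not> c t)) \<and>
      real (card C) \<le> real (card (shattered_subsets f A T)) ^ k * (1 + 1 / 2 ^ k) ^ card T"
  using assms
proof (induction T arbitrary: A rule: finite_induct)
  case empty
  show ?case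
  proof (cases "A = {}")
    case True
    then show ?thesis by (intro exI[of _ "{}"]) simp
  next
    case False
    then have "shattered_subsets f A {} = {{}}"
      unfolding shattered_subsets_def shattered_def by auto
    then show ?thesis by (intro exI[of _ "{\<lambda>_. True}"]) simp
  qed
next
  case (insert t T)
  define m where "m = card (shattered_subsets f A (insert t T))"
  define L :: real where "L = (1 + 1 / 2 ^ k) ^ card T"
  have L: "L \<ge> 0" unfolding L_def by simp
  text \<open>Keep the larger half together with the points undefined at \<open>t\<close>, and recurse separately
    into the smaller half.\<close>
  obtain b where b: "2 * card (shattered_subsets f {x \<in> A. f x t = Some (\<not> b)} T) \<le> m"
  proof -
    have "card (shattered_subsets f {x \<in> A. f x t = Some True} T) +
         card (shattered_subsets f {x \<in> A. f x t = Some False} T) \<le> m"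
      unfolding m_def using insert.hyps by (rule card_shattered_subsets_split)
    then show thesis using that[of True] that[of False] by fastforce
  qed
  let ?A1 = "{x \<in> A. f x t = Some (\<not> b)}" and ?A0 = "{x \<in> A. f x t \<noteq> Some (\<not> b)}"
  obtain C1 where C1: "finite C1" "\<forall>x\<in>?A1. \<exists>c\<in>C1. \<forall>s\<in>T. f x s \<noteq> Some (\<not> c s)"
    "real (card C1) \<le> real (card (shattered_subsets f ?A1 T)) ^ k * L"
    using insert.IH[of ?A1] unfolding L_def by blast
  obtain C0 where C0: "finite C0" "\<forall>x\<in>?A0. \<exists>c\<in>C0. \<forall>s\<in>T. f x s \<noteq> Some (\<not> c s)"
    "real (card C0) \<le> real (card (shattered_subsets f ?A0 T)) ^ k * L"
    using insert.IH[of ?A0] unfolding L_def by blast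
  define C where "C = (\<lambda>c. c(t := b)) ` C0 \<union> (\<lambda>c. c(t := \<not> b)) ` C1"
  have "\<exists>c\<in>C. \<forall>s\<in>insert t T. f x s \<noteq> Some (\<not> c s)" if "x \<in> A" for x
  proof (cases "f x t = Some (\<not> b)")
    case True
    then obtain c where c: "c \<in> C1" "\<forall>s\<in>T. f x s \<noteq> Some (\<not> c s)" using C1(2) \<open>x \<in> A\<close> by blast
    then have "\<forall>s\<in>insert t T. f x s \<noteq> Some (\<not> (c(t := \<not> b)) s)" using True by auto
    with c(1) show ?thesis unfolding C_def by blast
  next
    case False
    then obtain c where c: "c \<in> C0" "\<forall>s\<in>T. f x s \<noteq> Some (\<not> c s)" using C0(2) \<open>x \<in> A\<close> by blast
    then have "\<forall>s\<in>insert t T. f x s \<noteq> Some (\<not> (c(t := b)) s)" using False by auto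
    with c(1) show ?thesis unfolding C_def by blast
  qed
  moreover have "real (card C) \<le> real m ^ k * (1 + 1 / 2 ^ k) ^ card (insert t T)"
  proof -
    have "card (shattered_subsets f ?A0 T) \<le> m"
      unfolding m_def using insert.hyps
      by (intro card_mono finite_shattered_subsets shattered_subsets_mono) auto
    then have 0: "real (card C0) \<le> real m ^ k * L"
      by (intro order_trans[OF C0(3)] mult_right_mono power_mono L) auto
    \<comment> \<open>Halving before taking the \<open>k\<close>-th power is what produces the
      summand \<open>1 / 2 ^ k\<close>.\<close>
    have "real (card (shattered_subsets f ?A1 T)) \<le> real m / 2" using b by linarith
    then have 1: "real (card C1) \<le> (real m / 2) ^ k * L"
      by (intro order_trans[OF C1(3)] mult_right_mono power_mono L) auto
    have "card C \<le> card C0 + card C1"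
      unfolding C_def using C0(1) C1(1)
      by (intro order_trans[OF card_Un_le] add_mono card_image_le)
    then have "real (card C) \<le> real m ^ k * L + (real m / 2) ^ k * L" using 0 1 by linarith
    also have "\<dots> = real m ^ k * ((1 + 1 / 2 ^ k) * L)"
      by (simp add: power_divide algebra_simps)
    finally show ?thesis using insert.hyps unfolding L_def by simp
  qed
  moreover have "finite C" unfolding C_def using C0(1) C1(1) by simp
  ultimately show ?case unfolding m_def by blast
qed

text \<open>Shattering passes to subsets, so only the empty set and singletons can be
  shattered.\<close>

lemma card_shattered_subsets_no_pair:
  assumes "finite T" and no_pair: "\<And>s t. s \<in> T \<Longrightarrow> t \<in> T \<Longrightarrow> s \<noteq> t \<Longrightarrow> \<not> shattered f A {s, t}"
  shows "card (shattered_subsets f A T) \<le> Suc (card T)"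
proof -
  have "shattered_subsets f A T \<subseteq> insert {} ((\<lambda>t. {t}) ` T)"
  proof
    fix W assume W: "W \<in> shattered_subsets f A T"
    then have eq: "s = t" if "s \<in> W" "t \<in> W" for s t
      using no_pair[of s t] that shattered_subset[of f A W "{s, t}"]
      unfolding shattered_subsets_def by blast
    show "W \<in> insert {} ((\<lambda>t. {t}) ` T)"
    proof (cases "W = {}")
      case False
      then obtain t where "t \<in> W" by blast
      then have "W = {t}" using eq by blast
      then show ?thesis using W unfolding shattered_subsets_def by blast
    qed simp
  qed
  then have "card (shattered_subsets f A T) \<le> card (insert {} ((\<lambda>t. {t}) ` T))"
    using assms(1) by (intro card_mono) auto
  also have "\<dots> \<le> Suc (card ((\<lambda>t. {t}) ` T))" by (rule card_insert_le_m1) (auto simp: assms(1))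
  also have "\<dots> \<le> Suc (card T)" using assms(1) by (simp add: card_image_le)
  finally show ?thesis .
qed

section \<open>Covering numbers and visit patterns\<close>

lemma finite_subset_incseq:
  assumes "incseq J" "finite I" "I \<subseteq> (\<Union>n. J n)"
  shows "\<exists>n. I \<subseteq> J n"
  using assms(2,3)
proof (induction I rule: finite_induct)
  case (insert g I)
  then obtain n m where "I \<subseteq> J n" "g \<in> J m" by blast
  then have "insert g I \<subseteq> J (max n m)"
    using incseqD[OF assms(1), of n "max n m"] incseqD[OF assms(1), of m "max n m"] by auto
  then show ?case ..
qed simp

locale abelian_action = group_action G X \<phi> + comm_group G
  for G (structure) and X :: "'x::metric_space set" and \<phi> +
  assumes continuous_action: "g \<in> carrier G \<Longrightarrow> continuous_on X (\<phi> g)"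
begin

text \<open>\<open>None\<close> marks a time at which the point is in neither set, so that both
  members of the cover remain available to it.\<close>

definition pattern :: "'x set \<Rightarrow> 'x set \<Rightarrow> 'x \<Rightarrow> 'a \<Rightarrow> bool option" where
  "pattern U1 U2 x g =
     (if \<phi> g x \<in> U1 then Some True else if \<phi> g x \<in> U2 then Some False else None)"

abbreviation refined_cover :: "'x set \<Rightarrow> 'x set \<Rightarrow> 'a set \<Rightarrow> 'x set set" where
  "refined_cover U1 U2 I \<equiv> common_refinement X I (translated_cover G \<phi> {X - U1, X - U2})"

lemma action_in: "g \<in> carrier G \<Longrightarrow> x \<in> X \<Longrightarrow> \<phi> g x \<in> X"
  using element_image by blast

lemma action_inv:
  assumes "g \<in> carrier G" "x \<in> X"
  shows "\<phi> (inv g) (\<phi> g x) = x" "\<phi> g (\<phi> (inv g) x) = x"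
  using orbit_sym_aux[OF assms] orbit_sym_aux[of "inv g" x] assms by auto

lemma mem_translate_iff:
  assumes "g \<in> carrier G" "x \<in> X" "V \<subseteq> X"
  shows "x \<in> \<phi> (inv g) ` V \<longleftrightarrow> \<phi> g x \<in> V"
proof
  assume "x \<in> \<phi> (inv g) ` V"
  then show "\<phi> g x \<in> V" using assms action_inv by auto
next
  assume "\<phi> g x \<in> V"
  then show "x \<in> \<phi> (inv g) ` V" using assms action_inv(1)[of g x] by (metis image_eqI)
qed

text \<open>A total function selects one cell of the refined cover, and the cell contains every
  point whose visit pattern does not contradict the function.\<close>

lemma subcover_exists:
  assumes "I \<subseteq> carrier G" "U1 \<inter> U2 = {}" "finite C"
    and C: "\<forall>x\<in>X. \<exists>c\<in>C. \<forall>g\<in>I. pattern U1 U2 x g \<noteq> Some (\<not> c g)"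
  shows "\<exists>\<V>\<subseteq>refined_cover U1 U2 I. finite \<V> \<and> \<Union>\<V> = X \<and> card \<V> \<le> card C"
proof -
  \<comment> \<open>The value \<open>True\<close> selects the complement of \<open>U2\<close>: it
    must admit the points in \<open>U1\<close> and those in neither set.\<close>
  define cell where
    "cell c = X \<inter> (\<Inter>g\<in>I. \<phi> (inv g) ` (X - (if c g then U2 else U1)))" for c
  have "cell c \<in> refined_cover U1 U2 I" for c
    unfolding cell_def common_refinement_def translated_cover_def
    by (intro CollectI exI[of _ "\<lambda>g. \<phi> (inv g) ` (X - (if c g then U2 else U1))"]) auto
  moreover have "x \<in> \<Union>(cell ` C)" if "x \<in> X" for x
  proof -
    obtain c where c: "c \<in> C" "\<forall>g\<in>I. pattern U1 U2 x g \<noteq> Some (\<not> c g)"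
      using C \<open>x \<in> X\<close> by blast
    have "x \<in> \<phi> (inv g) ` (X - (if c g then U2 else U1))" if "g \<in> I" for g
    proof -
      have g: "g \<in> carrier G" using that assms(1) by blast
      have "\<phi> g x \<notin> (if c g then U2 else U1)"
        using c(2) that assms(2) unfolding pattern_def by (auto split: if_splits)
      then show ?thesis using mem_translate_iff[OF g \<open>x \<in> X\<close>] action_in[OF g \<open>x \<in> X\<close>] by simp
    qed
    then show ?thesis using c(1) \<open>x \<in> X\<close> unfolding cell_def by blast
  qed
  then have "\<Union>(cell ` C) = X" unfolding cell_def by blast
  ultimately show ?thesis
    using \<open>finite C\<close> by (intro exI[of _ "cell ` C"]) (auto simp: card_image_le)
qed

lemma subcover_number_le:
  assumes "I \<subseteq> carrier G" "U1 \<inter> U2 = {}" "finite C"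
    and "\<forall>x\<in>X. \<exists>c\<in>C. \<forall>g\<in>I. pattern U1 U2 x g \<noteq> Some (\<not> c g)"
  shows "subcover_number X (refined_cover U1 U2 I) \<le> card C"
proof -
  obtain \<V> where V: "\<V> \<subseteq> refined_cover U1 U2 I" "finite \<V>" "\<Union>\<V> = X" "card \<V> \<le> card C"
    using subcover_exists[OF assms] by blast
  then have "subcover_number X (refined_cover U1 U2 I) \<le> card \<V>"
    unfolding subcover_number_def by (intro Least_le) blast
  with V(4) show ?thesis by simp
qed

text \<open>At each time a cell misses \<open>U1\<close> or \<open>U2\<close>, so points realising
  different patterns lie in different cells, and there are \<open>2 ^ card I\<close>
  patterns.\<close>

lemma subcover_number_shattered:
  assumes "finite I" "I \<subseteq> carrier G" "U1 \<inter> U2 = {}" and sh: "shattered (pattern U1 U2) X I"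
  shows "2 ^ card I \<le> subcover_number X (refined_cover U1 U2 I)"
proof -
  \<comment> \<open>The size of \<open>C\<close> is irrelevant here. It provides some finite
    subcover, so that the \<open>LEAST\<close> in \<open>subcover_number\<close> is
    attained.\<close>
  obtain C where C: "finite C"
    "\<forall>x\<in>X. \<exists>c\<in>C. \<forall>g\<in>I. pattern U1 U2 x g \<noteq> Some (\<not> c g)"
    using partial_functions_cover[OF \<open>finite I\<close>, of X "pattern U1 U2"] by blast
  obtain \<V>0 where "\<V>0 \<subseteq> refined_cover U1 U2 I" "finite \<V>0" "\<Union>\<V>0 = X"
    using subcover_exists[OF assms(2,3) C] by blast
  then have "\<exists>\<V>\<subseteq>refined_cover U1 U2 I. finite \<V> \<and> \<Union>\<V> = X \<and>
      card \<V> = subcover_number X (refined_cover U1 U2 I)"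
    unfolding subcover_number_def
    by (rule_tac LeastI[of "\<lambda>k. \<exists>\<V>\<subseteq>refined_cover U1 U2 I. finite \<V> \<and> \<Union>\<V> = X \<and> card \<V> = k"
        "card \<V>0"]) blast
  then obtain \<V> where V: "\<V> \<subseteq> refined_cover U1 U2 I" "finite \<V>" "\<Union>\<V> = X"
    "card \<V> = subcover_number X (refined_cover U1 U2 I)" by blast
  have "\<forall>B\<in>Pow I. \<exists>x\<in>X. \<forall>g\<in>I. pattern U1 U2 x g = Some (g \<in> B)"
    using sh unfolding shattered_def by blast
  then obtain p where p: "\<And>B. B \<subseteq> I \<Longrightarrow> p B \<in> X"
    "\<And>B g. B \<subseteq> I \<Longrightarrow> g \<in> I \<Longrightarrow> pattern U1 U2 (p B) g = Some (g \<in> B)"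
    by (metis PowI)
  have "\<forall>B\<in>Pow I. \<exists>V\<in>\<V>. p B \<in> V" using p(1) V(3) by blast
  then obtain v where v: "\<And>B. B \<subseteq> I \<Longrightarrow> v B \<in> \<V>" "\<And>B. B \<subseteq> I \<Longrightarrow> p B \<in> v B"
    by (metis PowI)
  have agree: "\<not> (g \<in> B \<and> g \<notin> B')" if B: "B \<subseteq> I" "B' \<subseteq> I" "v B = v B'" and "g \<in> I" for B B' g
  proof
    assume gB: "g \<in> B \<and> g \<notin> B'"
    have g: "g \<in> carrier G" using \<open>g \<in> I\<close> assms(2) by blast
    have "v B \<in> refined_cover U1 U2 I" using v(1) B V(1) by blast
    then obtain c where c: "c \<in> Pi I (translated_cover G \<phi> {X - U1, X - U2})"
      "v B = X \<inter> (\<Inter>i\<in>I. c i)"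
      unfolding common_refinement_def by blast
    have "p B \<in> c g" "p B' \<in> c g" using v(2)[of B] v(2)[of B'] B c(2) \<open>g \<in> I\<close> by auto
    moreover have "c g = \<phi> (inv g) ` (X - U1) \<or> c g = \<phi> (inv g) ` (X - U2)"
      using c(1) \<open>g \<in> I\<close> unfolding translated_cover_def by auto
    moreover have "\<phi> g (p B) \<in> U1" "\<phi> g (p B') \<in> U2"
      using p(2)[of B g] p(2)[of B' g] B \<open>g \<in> I\<close> gB unfolding pattern_def
      by (auto split: if_splits)
    ultimately show False
      using mem_translate_iff[OF g p(1)[OF B(1)], of "X - U1"]
        mem_translate_iff[OF g p(1)[OF B(2)], of "X - U2"] by auto
  qed
  have "inj_on v (Pow I)"
  proof (rule inj_onI)
    fix B B' assume "B \<in> Pow I" "B' \<in> Pow I" "v B = v B'"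
    then show "B = B'" using agree[of B B'] agree[of B' B] by auto
  qed
  then have "card (Pow I) \<le> card \<V>"
    using v(1) V(2) by (intro card_inj_on_le[of v]) auto
  then show ?thesis using V(4) assms(1) by (simp add: card_Pow)
qed

section \<open>Sequence entropy and shattering\<close>

text \<open>Any \<open>m\<close> elements of \<open>S\<close> already lie in a single
  \<open>F n\<close>, since these sets increase to the whole group.\<close>

lemma card_inter_exhaustion_at_top:
  assumes "S \<subseteq> carrier G" "infinite S" "Folner_sequence G F"
  shows "filterlim (\<lambda>n. card (S \<inter> F n)) at_top sequentially"
  unfolding filterlim_at_top
proof
  fix m
  have F: "finite (F n)" "incseq F" "(\<Union>n. F n) = carrier G" for n
    using assms(3) unfolding Folner_sequence_def by auto
  obtain W where W: "finite W" "card W = m" "W \<subseteq> S"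
    using infinite_arbitrarily_large[OF assms(2)] by blast
  have "W \<subseteq> (\<Union>n. F n)" using W assms(1) F(3) by blast
  then obtain n where n: "W \<subseteq> F n"
    using finite_subset_incseq[OF F(2) W(1)] by blast
  have "m \<le> card (S \<inter> F k)" if "n \<le> k" for k
  proof -
    have "W \<subseteq> S \<inter> F k" using n W(3) incseqD[OF F(2) that] by blast
    then show ?thesis using W(2) F(1) card_mono[of "S \<inter> F k" W] by simp
  qed
  then show "\<forall>\<^sub>F k in sequentially. m \<le> card (S \<inter> F k)"
    unfolding eventually_sequentially by blast
qed

lemma sequence_entropy_pos_of_shattered:
  assumes "S \<subseteq> carrier G" "infinite S" "Folner_sequence G F" "U1 \<inter> U2 = {}"
    and sh: "\<And>I. finite I \<Longrightarrow> I \<subseteq> S \<Longrightarrow> shattered (pattern U1 U2) X I"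
  shows "sequence_entropy G X \<phi> F S {X - U1, X - U2} > 0"
proof -
  let ?N = "\<lambda>n. subcover_number X (refined_cover U1 U2 (S \<inter> F n))"
  \<comment> \<open>Once \<open>S\<close> meets \<open>F n\<close>, the average is a true quotient
    and is at least \<open>ln 2\<close>.\<close>
  have "\<forall>\<^sub>F n in sequentially. 1 \<le> card (S \<inter> F n)"
    using card_inter_exhaustion_at_top[OF assms(1-3)] unfolding filterlim_at_top by blast
  then have "\<forall>\<^sub>F n in sequentially.
      ereal (ln 2) \<le> ereal (1 / real (card (S \<inter> F n)) * ln (real (?N n)))"
  proof eventually_elim
    case (elim n)
    have "finite (S \<inter> F n)" using assms(3) unfolding Folner_sequence_def by blast
    then have "2 ^ card (S \<inter> F n) \<le> ?N n"
      using assms(1,4) sh by (intro subcover_number_shattered) auto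
    then have "(2::real) ^ card (S \<inter> F n) \<le> real (?N n)"
      by (metis of_nat_le_iff of_nat_numeral of_nat_power)
    then have "ln ((2::real) ^ card (S \<inter> F n)) \<le> ln (real (?N n))"
      by (intro ln_mono) (auto intro: less_le_trans[of 0 "2 ^ card (S \<inter> F n)"])
    then have "real (card (S \<inter> F n)) * ln 2 \<le> ln (real (?N n))"
      by (simp add: ln_realpow)
    then show ?case using elim by (simp add: field_simps)
  qed
  then have "ereal (ln 2) \<le> sequence_entropy G X \<phi> F S {X - U1, X - U2}"
    unfolding sequence_entropy_def
    by (intro order_trans[OF _ Liminf_le_Limsup] Liminf_bounded) auto
  moreover have "0 < ereal (ln 2)" by simp
  ultimately show ?thesis by (rule less_le_trans[rotated])
qed

text \<open>Without a shattered pair, \<open>I\<close> has at most \<open>card I + 1\<close>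
  shattered subsets, and the logarithm of the covering number is at most
  \<open>k * ln (1 + card I) + card I * ln (1 + 1 / 2 ^ k)\<close>. After division by
  \<open>card I\<close> the first term vanishes in the limit; then \<open>k\<close> tends to
  infinity.\<close>

lemma shattered_pair_of_sequence_entropy_pos:
  assumes S: "S \<subseteq> carrier G" "infinite S" and F: "Folner_sequence G F"
    and disj: "U1 \<inter> U2 = {}"
    and pos: "sequence_entropy G X \<phi> F S {X - U1, X - U2} > 0"
  obtains g h where "g \<in> S" "h \<in> S" "g \<noteq> h" "shattered (pattern U1 U2) X {g, h}"
proof -
  have False if no_pair: "\<And>g h. g \<in> S \<Longrightarrow> h \<in> S \<Longrightarrow> g \<noteq> h \<Longrightarrow> \<not> shattered (pattern U1 U2) X {g, h}"
  proof -
    let ?N = "\<lambda>n. subcover_number X (refined_cover U1 U2 (S \<inter> F n))"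
    \<comment> \<open>An inequality rather than an equation, because for \<open>n = 0\<close> both
      quotients are 0 and only \<open>L\<close> survives on the right.\<close>
    have avg: "1 / n * (a + n * L) \<le> a / n + L" if "L \<ge> 0" for L n a :: real
      using that by (cases "n = 0") (auto simp: distrib_left)
    have top: "filterlim (\<lambda>n. card (S \<inter> F n)) at_top sequentially"
      using card_inter_exhaustion_at_top[OF S F] .
    have bound: "sequence_entropy G X \<phi> F S {X - U1, X - U2} \<le> ereal (ln (1 + 1 / 2 ^ k))" for k
    proof -
      define r :: "nat \<Rightarrow> real"
        where "r m = real k * (ln (1 + real m) / real m) + ln (1 + 1 / 2 ^ k)" for m
      have "(\<lambda>m. ln (1 + real m) / real m) \<longlonglongrightarrow> 0" by real_asymp
      then have "r \<longlonglongrightarrow> real k * 0 + ln (1 + 1 / 2 ^ k)"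
        unfolding r_def by (intro tendsto_intros)
      then have "(\<lambda>n. r (card (S \<inter> F n))) \<longlonglongrightarrow> ln (1 + 1 / 2 ^ k)"
        using filterlim_compose[OF _ top] by simp
      then have lim: "limsup (\<lambda>n. ereal (r (card (S \<inter> F n)))) = ereal (ln (1 + 1 / 2 ^ k))"
        by (intro lim_imp_Limsup) auto
      have "1 / real (card (S \<inter> F n)) * ln (real (?N n)) \<le> r (card (S \<inter> F n))" for n
      proof -
        define I where "I = S \<inter> F n"
        have I: "finite I" "I \<subseteq> carrier G" "I \<subseteq> S"
          using F S unfolding I_def Folner_sequence_def by auto
        have "1 + 1 / 2 ^ k > (0::real)" by (simp add: add_pos_nonneg)
        then have nz: "1 + 1 / 2 ^ k \<noteq> (0::real)" by linarith
        define b :: real where "b = (1 + real (card I)) ^ k * (1 + 1 / 2 ^ k) ^ card I"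
        obtain C where C: "finite C"
          "\<forall>x\<in>X. \<exists>c\<in>C. \<forall>t\<in>I. pattern U1 U2 x t \<noteq> Some (\<not> c t)"
          "real (card C) \<le>
             real (card (shattered_subsets (pattern U1 U2) X I)) ^ k * (1 + 1 / 2 ^ k) ^ card I"
          using partial_functions_cover[OF I(1), of X "pattern U1 U2" k] by blast
        have "card (shattered_subsets (pattern U1 U2) X I) \<le> Suc (card I)"
          using I(1,3) no_pair by (intro card_shattered_subsets_no_pair) blast+
        then have "real (card C) \<le> b"
          unfolding b_def by (intro order_trans[OF C(3)] mult_right_mono power_mono) auto
        moreover have "?N n \<le> card C"
          using subcover_number_le[OF I(2) disj C(1,2)] unfolding I_def .
        ultimately have "real (?N n) \<le> b" by linarith
        moreover have "1 \<le> b"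
          unfolding b_def by (intro mult_ge1_I one_le_power) auto
        \<comment> \<open>For empty \<open>X\<close> the covering number is 0 and
          \<open>ln 0 = 0\<close>; there \<open>1 \<le> b\<close> gives the bound.\<close>
        ultimately have "ln (real (?N n)) \<le> ln b"
          by (cases "?N n = 0") (auto intro: ln_mono)
        also have "\<dots> = real k * ln (1 + real (card I)) + real (card I) * ln (1 + 1 / 2 ^ k)"
          unfolding b_def by (subst ln_mult) (simp_all add: ln_realpow nz)
        finally have "1 / real (card I) * ln (real (?N n)) \<le>
          1 / real (card I) * (real k * ln (1 + real (card I)) + real (card I) * ln (1 + 1 / 2 ^ k))"
          by (intro mult_left_mono) auto
        also have "\<dots> \<le> r (card I)"
          using avg[of "ln (1 + 1 / 2 ^ k)" "real (card I)" "real k * ln (1 + real (card I))"]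
          unfolding r_def by simp
        finally show ?thesis unfolding I_def .
      qed
      then show ?thesis
        unfolding sequence_entropy_def lim[symmetric]
        by (intro Limsup_mono always_eventually) simp
    qed
    \<comment> \<open>The entropy does not depend on \<open>k\<close>, so it is at most the limit of
      the bounds.\<close>
    have "(\<lambda>k. ln (1 + 1 / 2 ^ k :: real)) \<longlonglongrightarrow> 0" by real_asymp
    then have "(\<lambda>k. ereal (ln (1 + 1 / 2 ^ k))) \<longlonglongrightarrow> ereal 0" by (rule tendsto_ereal)
    then have "sequence_entropy G X \<phi> F S {X - U1, X - U2} \<le> ereal 0"
      by (rule LIMSEQ_le_const) (use bound in auto)
    with pos show False by (simp add: zero_ereal_def)
  qed
  then show thesis using that by blast
qed

section \<open>Hitting sets\<close>

text \<open>The hitting-time set \<open>N(U, V)\<close>, written with forward images so that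
  inverses are confined to the comparison with the definition of weak mixing.\<close>

definition hits :: "'x set \<Rightarrow> 'x set \<Rightarrow> 'a set" where
  "hits U V = {g \<in> carrier G. \<exists>x\<in>U. \<phi> g x \<in> V}"

abbreviation "nonempty_open U \<equiv> openin (top_of_set X) U \<and> U \<noteq> {}"

lemma openin_mem_carrier: "openin (top_of_set X) U \<Longrightarrow> x \<in> U \<Longrightarrow> x \<in> X"
  by (meson openin_imp_subset subsetD)

lemma hits_iff:
  assumes "U \<subseteq> X" "V \<subseteq> X" "g \<in> carrier G"
  shows "g \<in> hits U V \<longleftrightarrow> U \<inter> \<phi> (inv g) ` V \<noteq> {}"
  using assms mem_translate_iff[OF assms(3) _ assms(2)] unfolding hits_def by blast

lemma weakly_mixing_iff_hits:
  "weakly_mixing G X \<phi> \<longleftrightarrow>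
     (\<forall>U1 U2 V1 V2. nonempty_open U1 \<and> nonempty_open U2 \<and> nonempty_open V1 \<and> nonempty_open V2
        \<longrightarrow> hits U1 V1 \<inter> hits U2 V2 \<noteq> {})"
proof -
  have "(\<exists>g \<in> carrier G. U1 \<inter> \<phi> (inv g) ` V1 \<noteq> {} \<and> U2 \<inter> \<phi> (inv g) ` V2 \<noteq> {}) \<longleftrightarrow>
      hits U1 V1 \<inter> hits U2 V2 \<noteq> {}"
    if "nonempty_open U1" "nonempty_open U2" "nonempty_open V1" "nonempty_open V2" for U1 U2 V1 V2
  proof -
    have "U1 \<subseteq> X" "U2 \<subseteq> X" "V1 \<subseteq> X" "V2 \<subseteq> X"
      using that openin_imp_subset by metis+
    then have "(\<exists>g \<in> carrier G. U1 \<inter> \<phi> (inv g) ` V1 \<noteq> {} \<and> U2 \<inter> \<phi> (inv g) ` V2 \<noteq> {}) \<longleftrightarrow>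
        (\<exists>g \<in> carrier G. g \<in> hits U1 V1 \<and> g \<in> hits U2 V2)"
      by (intro bex_cong) (simp_all add: hits_iff)
    also have "\<dots> \<longleftrightarrow> hits U1 V1 \<inter> hits U2 V2 \<noteq> {}"
      unfolding hits_def by blast
    finally show ?thesis .
  qed
  then show ?thesis
    unfolding weakly_mixing_def by (intro iff_allI imp_cong) simp_all
qed

lemma openin_preimage:
  assumes "g \<in> carrier G" "openin (top_of_set X) V"
  shows "openin (top_of_set X) {x \<in> X. \<phi> g x \<in> V}"
proof -
  have "openin (top_of_set X) (X \<inter> \<phi> g -` V)"
    using continuous_action assms action_in by (intro continuous_openin_preimage) auto
  moreover have "X \<inter> \<phi> g -` V = {x \<in> X. \<phi> g x \<in> V}" by auto
  ultimately show ?thesis by simp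
qed

lemma nonempty_open_preimage:
  assumes "g \<in> carrier G" "nonempty_open V"
  shows "nonempty_open {x \<in> X. \<phi> g x \<in> V}"
proof -
  obtain v where v: "v \<in> V" "v \<in> X" using assms(2) openin_imp_subset by blast
  then have "\<phi> (inv g) v \<in> {x \<in> X. \<phi> g x \<in> V}"
    using action_inv(2)[OF assms(1) v(2)] action_in[of "inv g" v] assms(1) by simp
  then show ?thesis using openin_preimage assms by blast
qed

lemma openin_preimage_inter:
  assumes "g \<in> carrier G" "openin (top_of_set X) U" "openin (top_of_set X) V"
  shows "openin (top_of_set X) {x \<in> U. \<phi> g x \<in> V}"
proof -
  have "{x \<in> U. \<phi> g x \<in> V} = U \<inter> {x \<in> X. \<phi> g x \<in> V}"
    using openin_imp_subset[OF assms(2)] by blast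
  then show ?thesis using assms openin_preimage by auto
qed

lemma action_commute:
  assumes "g \<in> carrier G" "h \<in> carrier G" "x \<in> X"
  shows "\<phi> g (\<phi> h x) = \<phi> h (\<phi> g x)"
  using composition_rule[OF assms(3,1,2)] composition_rule[OF assms(3,2,1)]
    m_comm[OF assms(1,2)] by simp

text \<open>Furstenberg's intersection lemma. Take \<open>g\<close> in \<open>N(U1, U2)\<close> and
  \<open>N(V1, V2)\<close>, and shrink \<open>U1\<close> and \<open>V1\<close> to the points that
  \<open>g\<close> sends into \<open>U2\<close> and \<open>V2\<close>. If \<open>h\<close> carries
  \<open>x\<close> from the first set to the second, then by commutativity it carries
  \<open>gx\<close> from \<open>U2\<close> to \<open>V2\<close>.\<close>

lemma hits_inter:
  assumes wm: "weakly_mixing G X \<phi>"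
    and o: "nonempty_open U1" "nonempty_open V1" "nonempty_open U2" "nonempty_open V2"
  obtains U V where "nonempty_open U" "nonempty_open V" "hits U V \<subseteq> hits U1 V1 \<inter> hits U2 V2"
proof -
  obtain g where "g \<in> hits U1 U2" "g \<in> hits V1 V2"
    using wm o unfolding weakly_mixing_iff_hits by blast
  then have g: "g \<in> carrier G" "{x \<in> U1. \<phi> g x \<in> U2} \<noteq> {}" "{x \<in> V1. \<phi> g x \<in> V2} \<noteq> {}"
    unfolding hits_def by auto
  have "hits {x \<in> U1. \<phi> g x \<in> U2} {x \<in> V1. \<phi> g x \<in> V2} \<subseteq> hits U1 V1 \<inter> hits U2 V2"
  proof
    fix h assume "h \<in> hits {x \<in> U1. \<phi> g x \<in> U2} {x \<in> V1. \<phi> g x \<in> V2}"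
    then obtain x where x: "h \<in> carrier G" "x \<in> U1" "\<phi> g x \<in> U2" "\<phi> h x \<in> V1" "\<phi> g (\<phi> h x) \<in> V2"
      unfolding hits_def by blast
    have "x \<in> X" using x(2) o(1) openin_imp_subset by blast
    then have "\<phi> h (\<phi> g x) \<in> V2" using x(5) action_commute[OF g(1) x(1)] by simp
    then show "h \<in> hits U1 V1 \<inter> hits U2 V2" using x unfolding hits_def by blast
  qed
  then show thesis using that g openin_preimage_inter o by meson
qed

lemma hits_finite_inter:
  assumes wm: "weakly_mixing G X \<phi>" and "X \<noteq> {}" "finite P"
    and "\<And>U V. (U, V) \<in> P \<Longrightarrow> nonempty_open U \<and> nonempty_open V"
  shows "\<exists>g\<in>carrier G. \<forall>(U, V)\<in>P. g \<in> hits U V"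
proof -
  \<comment> \<open>The induction produces a pair of open sets rather than a group element, since a
    pair can be fed into \<open>hits_inter\<close> again.\<close>
  have "\<exists>U V. nonempty_open U \<and> nonempty_open V \<and> (\<forall>(U', V')\<in>P. hits U V \<subseteq> hits U' V')"
    using assms(3,4)
  proof (induction P rule: finite_induct)
    case empty
    then show ?case using \<open>X \<noteq> {}\<close> by (intro exI[of _ X]) simp
  next
    case (insert p P)
    obtain U1 V1 where 1: "nonempty_open U1" "nonempty_open V1"
      "\<forall>(U', V')\<in>P. hits U1 V1 \<subseteq> hits U' V'"
      using insert.IH insert.prems by (metis insertCI)
    obtain U2 V2 where p: "p = (U2, V2)" by fastforce
    then have 2: "nonempty_open U2" "nonempty_open V2" using insert.prems[of U2 V2] by auto
    obtain U V where "nonempty_open U" "nonempty_open V" "hits U V \<subseteq> hits U1 V1 \<inter> hits U2 V2"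
      by (rule hits_inter[OF wm 1(1,2) 2])
    then have "nonempty_open U \<and> nonempty_open V \<and> (\<forall>(U', V')\<in>insert p P. hits U V \<subseteq> hits U' V')"
      using 1(3) p by fast
    then show ?case by (intro exI)
  qed
  then obtain U V where UV: "nonempty_open U" "nonempty_open V"
    and sub: "\<forall>(U', V')\<in>P. hits U V \<subseteq> hits U' V'" by metis
  have "hits U V \<inter> hits U V \<noteq> {}" using wm UV unfolding weakly_mixing_iff_hits by metis
  then obtain g where "g \<in> hits U V" by blast
  moreover from this have "g \<in> carrier G" unfolding hits_def by blast
  ultimately show ?thesis using sub by blast
qed

section \<open>Weak mixing implies positive entropy\<close>

text \<open>The points realising a given pattern on \<open>I\<close> form a nonempty open set. A
  single \<open>g\<close> that sends each of these finitely many sets into both \<open>V1\<close>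
  and \<open>V2\<close> adds a free coordinate to every pattern.\<close>

lemma shattered_extend:
  assumes wm: "weakly_mixing G X \<phi>"
    and V: "nonempty_open V1" "nonempty_open V2" "V1 \<inter> V2 = {}"
    and I: "finite I" "I \<subseteq> carrier G" "shattered (pattern V1 V2) X I"
  shows "\<exists>g\<in>carrier G. g \<notin> I \<and> shattered (pattern V1 V2) X (insert g I)"
proof -
  have X: "X \<noteq> {}" using V(1) openin_imp_subset by blast
  define W where "W B = {x \<in> X. \<forall>g\<in>I. \<phi> g x \<in> (if g \<in> B then V1 else V2)}" for B
  have W_pattern: "x \<in> W B \<longleftrightarrow> x \<in> X \<and> (\<forall>g\<in>I. pattern V1 V2 x g = Some (g \<in> B))" for x B
    unfolding W_def pattern_def using V(3) by auto
  \<comment> \<open>The case \<open>I = {}\<close> is separate because an empty intersection would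
    be \<open>UNIV\<close> instead of \<open>X\<close>.\<close>
  have "openin (top_of_set X) (W B)" for B
  proof (cases "I = {}")
    case True
    then show ?thesis unfolding W_def by simp
  next
    case False
    have eq: "W B = (\<Inter>g\<in>I. {x \<in> X. \<phi> g x \<in> (if g \<in> B then V1 else V2)})"
      unfolding W_def using False by (auto split del: if_split)
    show ?thesis
      unfolding eq using I V False by (intro openin_INT2 openin_preimage) auto
  qed
  then have W: "nonempty_open (W B)" if "B \<subseteq> I" for B
    using I(3) that W_pattern unfolding shattered_def by blast
  have "\<exists>g\<in>carrier G. \<forall>(U, V)\<in>W ` Pow I \<times> {V1, V2}. g \<in> hits U V"
    using wm X I(1) V W by (intro hits_finite_inter) auto
  then obtain g where g: "g \<in> carrier G"
    "\<And>B. B \<subseteq> I \<Longrightarrow> g \<in> hits (W B) V1" "\<And>B. B \<subseteq> I \<Longrightarrow> g \<in> hits (W B) V2"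
    by auto
  \<comment> \<open>If \<open>g\<close> were in \<open>I\<close>, all points of \<open>W I\<close>
    would be sent into \<open>V1\<close> by \<open>g\<close>, yet one of them is sent into
    \<open>V2\<close>.\<close>
  have "g \<notin> I"
  proof
    assume "g \<in> I"
    obtain x where "x \<in> W I" "\<phi> g x \<in> V2" using g(3)[of I] unfolding hits_def by blast
    then show False using \<open>g \<in> I\<close> V(3) unfolding W_def by auto
  qed
  moreover have "shattered (pattern V1 V2) X (insert g I)"
    unfolding shattered_def
  proof (intro allI impI)
    fix B assume "B \<subseteq> insert g I"
    then have "B - {g} \<subseteq> I" by blast
    then have "g \<in> hits (W (B - {g})) (if g \<in> B then V1 else V2)"
      using g(2)[of "B - {g}"] g(3)[of "B - {g}"] by presburger
    then obtain x where x: "x \<in> W (B - {g})" "\<phi> g x \<in> (if g \<in> B then V1 else V2)"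
      unfolding hits_def by blast
    have "pattern V1 V2 x g = Some (g \<in> B)" using x(2) V(3) unfolding pattern_def by (auto split: if_splits)
    moreover have "\<forall>h\<in>I. pattern V1 V2 x h = Some (h \<in> B)"
      using x(1) \<open>g \<notin> I\<close> unfolding W_pattern by auto
    moreover have "x \<in> X" using x(1) unfolding W_def by blast
    ultimately show "\<exists>x\<in>X. \<forall>t\<in>insert g I. pattern V1 V2 x t = Some (t \<in> B)" by blast
  qed
  ultimately show ?thesis using g(1) by blast
qed

text \<open>Iterating the extension gives a strictly increasing chain of finite shattered sets.
  Every finite subset of the union lies in one member of the chain.\<close>

lemma infinite_shattered:
  assumes wm: "weakly_mixing G X \<phi>"
    and V: "nonempty_open V1" "nonempty_open V2" "V1 \<inter> V2 = {}"
  obtains S where "S \<subseteq> carrier G" "infinite S"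
    "\<And>I. finite I \<Longrightarrow> I \<subseteq> S \<Longrightarrow> shattered (pattern V1 V2) X I"
proof -
  let ?good = "\<lambda>I. finite I \<and> I \<subseteq> carrier G \<and> shattered (pattern V1 V2) X I"
  have X: "X \<noteq> {}" using V(1) openin_imp_subset by blast
  have "\<exists>J. \<forall>n::nat. ?good (J n) \<and> J n \<subset> J (Suc n)"
  proof (rule dependent_nat_choice)
    show "\<exists>I. ?good I" using X by (intro exI[of _ "{}"]) (auto simp: shattered_def)
  next
    fix I and n :: nat assume "?good I"
    then obtain g where "g \<in> carrier G" "g \<notin> I" "shattered (pattern V1 V2) X (insert g I)"
      using shattered_extend[OF wm V] by blast
    then show "\<exists>I'. ?good I' \<and> I \<subset> I'" using \<open>?good I\<close> by (intro exI[of _ "insert g I"]) auto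
  qed
  then obtain J :: "nat \<Rightarrow> 'a set" where "\<forall>n. ?good (J n) \<and> J n \<subset> J (Suc n)" ..
  then have J: "?good (J n)" "J n \<subset> J (Suc n)" for n by simp_all
  have mono: "incseq J" using J(2) by (intro incseq_SucI) blast
  have "strict_mono J" using J(2) by (simp add: strict_mono_Suc_iff)
  then have "inj J" by (rule strict_mono_imp_inj_on)
  have inf: "infinite (\<Union>n. J n)"
  proof
    assume "finite (\<Union>n. J n)"
    then have "finite (range J)" by (rule finite_UnionD)
    then show False using \<open>inj J\<close> finite_imageD by blast
  qed
  have "shattered (pattern V1 V2) X I" if I: "finite I" "I \<subseteq> (\<Union>n. J n)" for I
  proof -
    obtain n where "I \<subseteq> J n" using finite_subset_incseq[OF mono I] by blast
    then show ?thesis using J(1)[of n] shattered_subset by metis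
  qed
  moreover have "(\<Union>n. J n) \<subseteq> carrier G" using J(1) by (intro UN_least) simp
  ultimately show thesis using inf that by metis
qed

text \<open>Weak mixing concerns open sets, so the shattered sequence is built for the interiors of
  the closed neighbourhoods.\<close>

lemma weakly_mixing_imp_upse:
  assumes wm: "weakly_mixing G X \<phi>" and F: "Folner_sequence G F"
  shows "uniform_positive_sequence_entropy G X \<phi> F"
  unfolding uniform_positive_sequence_entropy_def sequence_entropy_pair_def
proof (intro ballI impI conjI allI)
  fix x1 x2 U1 U2
  assume "closed_neighborhood X x1 U1 \<and> closed_neighborhood X x2 U2 \<and> U1 \<inter> U2 = {}"
  then have U: "x1 \<in> (top_of_set X) interior_of U1" "x2 \<in> (top_of_set X) interior_of U2"
    "U1 \<inter> U2 = {}" unfolding closed_neighborhood_def by simp_all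
  define V1 V2 where "V1 = (top_of_set X) interior_of U1" and "V2 = (top_of_set X) interior_of U2"
  have V: "V1 \<subseteq> U1" "V2 \<subseteq> U2" "nonempty_open V1" "nonempty_open V2"
    using U(1,2) unfolding V1_def V2_def
    by (simp_all add: interior_of_subset openin_interior_of) (metis empty_iff)+
  then have "V1 \<inter> V2 = {}" using U(3) by blast
  then obtain S where S: "S \<subseteq> carrier G" "infinite S"
    "\<And>I. finite I \<Longrightarrow> I \<subseteq> S \<Longrightarrow> shattered (pattern V1 V2) X I"
    using infinite_shattered[OF wm V(3,4)] by blast
  \<comment> \<open>Enlarging the sets can only turn \<open>None\<close> into a value, because
    \<open>U1\<close> and \<open>U2\<close> are still disjoint; shattering thus survives.\<close>
  have "pattern U1 U2 x g = Some b" if "pattern V1 V2 x g = Some b" for x g b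
    using that V(1,2) U(3) unfolding pattern_def by (auto split: if_splits)
  then have "shattered (pattern U1 U2) X I" if "finite I" "I \<subseteq> S" for I
    using S(3)[OF that] unfolding shattered_def by meson
  then have "sequence_entropy G X \<phi> F S {X - U1, X - U2} > 0"
    using S F U(3) by (intro sequence_entropy_pos_of_shattered) auto
  with S show "\<exists>S\<subseteq>carrier G. infinite S \<and> sequence_entropy G X \<phi> F S {X - U1, X - U2} > 0"
    by blast
qed

section \<open>Positive entropy implies weak mixing\<close>

lemma closed_neighborhood_cball:
  assumes "x \<in> X" "r > 0"
  shows "closed_neighborhood X x (X \<inter> cball x r)"
proof -
  have "openin (top_of_set X) (X \<inter> ball x r)" by (simp add: openin_open_Int)
  moreover have "X \<inter> ball x r \<subseteq> X \<inter> cball x r" by auto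
  ultimately have "X \<inter> ball x r \<subseteq> (top_of_set X) interior_of (X \<inter> cball x r)"
    by (rule interior_of_maximal[rotated])
  then show ?thesis
    using assms unfolding closed_neighborhood_def by (auto simp: closedin_closed_Int)
qed

text \<open>For a shattered pair, some \<open>x\<close> visits \<open>U1\<close> at times
  \<open>g\<close> and \<open>h\<close>, and some \<open>y\<close> visits \<open>U1\<close> at
  \<open>g\<close> and \<open>U2\<close> at \<open>h\<close>. The element \<open>k\<close>, which is
  \<open>h\<close> times the inverse of \<open>g\<close>, moves \<open>gx\<close> to
  \<open>hx\<close> and \<open>gy\<close> to \<open>hy\<close>.\<close>

lemma upse_hits:
  assumes upse: "uniform_positive_sequence_entropy G X \<phi> F" and F: "Folner_sequence G F"
    and o: "nonempty_open U" "nonempty_open V"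
  shows "hits U U \<inter> hits U V \<noteq> {}"
proof (cases "\<exists>x1\<in>U. \<exists>x2\<in>V. x1 \<noteq> x2")
  \<comment> \<open>Here \<open>U\<close> and \<open>V\<close> are the same singleton, and the
    identity serves.\<close>
  case False
  obtain x where xU: "x \<in> U" using o(1) by (meson ex_in_conv)
  obtain y where yV: "y \<in> V" using o(2) by (meson ex_in_conv)
  have "x = y" using False[simplified, rule_format, OF xU yV] .
  then have x: "x \<in> U" "x \<in> V" using xU yV by simp_all
  then have "x \<in> X" using o(1) openin_mem_carrier by metis
  then have "\<phi> \<one> x = x" using id_eq_one by (metis restrict_apply)
  then have "\<one> \<in> hits U U \<inter> hits U V" using x unfolding hits_def by (auto intro!: bexI[of _ x])
  then show ?thesis by blast
next
  case True
  then obtain x1 x2 where x: "x1 \<in> U" "x2 \<in> V" "x1 \<noteq> x2" by blast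
  then have xX: "x1 \<in> X" "x2 \<in> X" using o openin_mem_carrier by blast+
  obtain e1 where e1: "e1 > 0" "cball x1 e1 \<inter> X \<subseteq> U"
    using o(1) x(1) unfolding openin_contains_cball by blast
  obtain e2 where e2: "e2 > 0" "cball x2 e2 \<inter> X \<subseteq> V"
    using o(2) x(2) unfolding openin_contains_cball by blast
  \<comment> \<open>A third of the distance keeps the two closed balls disjoint.\<close>
  define r where "r = min (min e1 e2) (dist x1 x2 / 3)"
  have r: "r > 0" "r \<le> e1" "r \<le> e2" "r \<le> dist x1 x2 / 3"
    using e1(1) e2(1) x(3) unfolding r_def by auto
  define U1 U2 where "U1 = X \<inter> cball x1 r" and "U2 = X \<inter> cball x2 r"
  have sub: "U1 \<subseteq> U" "U2 \<subseteq> V" using e1(2) e2(2) r unfolding U1_def U2_def by auto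
  have disj: "U1 \<inter> U2 = {}"
  proof -
    have False if "dist x1 y \<le> r" "dist x2 y \<le> r" for y
    proof -
      have "0 < dist x1 x2" using x(3) by simp
      moreover have "dist x1 x2 \<le> dist x1 y + dist x2 y" by (rule dist_triangle2)
      ultimately show False using that r(4) by linarith
    qed
    then show ?thesis unfolding U1_def U2_def by auto
  qed
  have "closed_neighborhood X x1 U1" "closed_neighborhood X x2 U2"
    unfolding U1_def U2_def using xX r(1) by (simp_all add: closed_neighborhood_cball)
  then obtain S where S: "S \<subseteq> carrier G" "infinite S"
    "sequence_entropy G X \<phi> F S {X - U1, X - U2} > 0"
    using upse xX x(3) disj
    unfolding uniform_positive_sequence_entropy_def sequence_entropy_pair_def by meson
  obtain g h where gh: "g \<in> S" "h \<in> S" "g \<noteq> h" "shattered (pattern U1 U2) X {g, h}"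
    using shattered_pair_of_sequence_entropy_pos[OF S(1,2) F disj S(3)] by blast
  then have g: "g \<in> carrier G" "h \<in> carrier G" using S(1) by auto
  define k where "k = h \<otimes> inv g"
  have k: "k \<in> carrier G" unfolding k_def using g by simp
  have k_act: "\<phi> k (\<phi> g x) = \<phi> h x" if "x \<in> X" for x
    unfolding k_def using composition_rule[of "\<phi> g x" h "inv g"] g that action_in action_inv
    by simp
  obtain x where "x \<in> X" "pattern U1 U2 x g = Some True" "pattern U1 U2 x h = Some True"
    using gh(4)[unfolded shattered_def, rule_format, of "{g, h}"] by auto
  then have "\<phi> g x \<in> U" "\<phi> k (\<phi> g x) \<in> U"
    using sub k_act unfolding pattern_def by (auto split: if_splits)
  then have "k \<in> hits U U" using k unfolding hits_def by blast
  moreover obtain y where "y \<in> X" "pattern U1 U2 y g = Some True" "pattern U1 U2 y h = Some False"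
    using gh(4)[unfolded shattered_def, rule_format, of "{g}"] gh(3) by auto
  then have "\<phi> g y \<in> U" "\<phi> k (\<phi> g y) \<in> V"
    using sub k_act unfolding pattern_def by (auto split: if_splits)
  then have "k \<in> hits U V" using k unfolding hits_def by blast
  ultimately show ?thesis by blast
qed

text \<open>Two bootstraps: first the target \<open>U\<close> is replaced by an arbitrary open set,
  then the common source is split into two arbitrary ones.\<close>

lemma weakly_mixing_of_hits:
  assumes hyp: "\<And>U V. nonempty_open U \<Longrightarrow> nonempty_open V \<Longrightarrow> hits U U \<inter> hits U V \<noteq> {}"
  shows "weakly_mixing G X \<phi>"
proof -
  have step: "hits U V \<inter> hits U V' \<noteq> {}"
    if o: "nonempty_open U" "nonempty_open V" "nonempty_open V'" for U V V'
  proof -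
    obtain g where "g \<in> hits U V" using hyp[OF o(1,2)] by blast
    \<comment> \<open>If \<open>k\<close> sends a point of \<open>A\<close> into \<open>A\<close>
      and another one into \<open>B\<close>, then applying \<open>g\<close> afterwards leads from
      \<open>U\<close> to \<open>V\<close> and to \<open>V'\<close>.\<close>
    define A where "A = {x \<in> U. \<phi> g x \<in> V}"
    define B where "B = {x \<in> X. \<phi> g x \<in> V'}"
    have g: "g \<in> carrier G" "A \<noteq> {}" using \<open>g \<in> hits U V\<close> unfolding hits_def A_def by auto
    have "nonempty_open A"
      using openin_preimage_inter[OF g(1), of U V] g(2) o unfolding A_def by simp
    moreover have "nonempty_open B"
      unfolding B_def using g(1) o(3) by (rule nonempty_open_preimage)
    ultimately have "hits A A \<inter> hits A B \<noteq> {}" by (rule hyp)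
    then obtain k where "k \<in> hits A A" "k \<in> hits A B" by blast
    then obtain x y where k: "k \<in> carrier G" "x \<in> A" "\<phi> k x \<in> A" "y \<in> A" "\<phi> k y \<in> B"
      unfolding hits_def by blast
    have AX: "x \<in> X" "y \<in> X" using k(2,4) o(1) openin_mem_carrier unfolding A_def by blast+
    have "\<phi> (g \<otimes> k) x \<in> V" "\<phi> (g \<otimes> k) y \<in> V'"
      using k composition_rule[OF AX(1) g(1) k(1)] composition_rule[OF AX(2) g(1) k(1)]
      unfolding A_def B_def by auto
    moreover have "x \<in> U" "y \<in> U" using k unfolding A_def by auto
    moreover have "g \<otimes> k \<in> carrier G" using g k by simp
    ultimately have "g \<otimes> k \<in> hits U V \<inter> hits U V'" unfolding hits_def by blast
    then show ?thesis by blast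
  qed
  have "hits U1 V1 \<inter> hits U2 V2 \<noteq> {}"
    if o: "nonempty_open U1" "nonempty_open U2" "nonempty_open V1" "nonempty_open V2"
    for U1 U2 V1 V2
  proof -
    obtain g where "g \<in> hits U1 U2" using hyp[OF o(1,2)] by blast
    \<comment> \<open>For \<open>y\<close> in \<open>W\<close> the point \<open>gy\<close> is in
      \<open>U2\<close>. If \<open>hy\<close> is in \<open>B\<close>, then \<open>h\<close> sends
      \<open>gy\<close> to \<open>ghy\<close> in \<open>V2\<close>, again by commutativity.\<close>
    define W where "W = {x \<in> U1. \<phi> g x \<in> U2}"
    define B where "B = {x \<in> X. \<phi> g x \<in> V2}"
    have g: "g \<in> carrier G" "W \<noteq> {}" using \<open>g \<in> hits U1 U2\<close> unfolding hits_def W_def by auto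
    have "nonempty_open W"
      using openin_preimage_inter[OF g(1), of U1 U2] g(2) o unfolding W_def by simp
    moreover have "nonempty_open B"
      unfolding B_def using g(1) o(4) by (rule nonempty_open_preimage)
    ultimately have "hits W V1 \<inter> hits W B \<noteq> {}" using o(3) step by blast
    then obtain h where "h \<in> hits W V1" "h \<in> hits W B" by blast
    then obtain x y where h: "h \<in> carrier G" "x \<in> W" "\<phi> h x \<in> V1" "y \<in> W" "\<phi> h y \<in> B"
      unfolding hits_def by blast
    have "y \<in> X" using h(4) o(1) openin_mem_carrier unfolding W_def by blast
    then have "\<phi> h (\<phi> g y) \<in> V2"
      using h(5) action_commute[OF g(1) h(1)] unfolding B_def by simp
    then have "h \<in> hits U1 V1 \<inter> hits U2 V2"
      using h unfolding hits_def W_def by blast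
    then show ?thesis by blast
  qed
  then show ?thesis unfolding weakly_mixing_iff_hits by blast
qed

end

theorem theorem5p5:
  fixes G :: "('g, 'b) monoid_scheme"
    and F :: "nat \<Rightarrow> 'g set"
    and X :: "'x::metric_space set"
    and \<phi> :: "'g \<Rightarrow> 'x \<Rightarrow> 'x"
  assumes "comm_group G" and "infinite (carrier G)" and "countable (carrier G)"
    and "Folner_sequence G F"
    and "G_system G X \<phi>"
  shows "weakly_mixing G X \<phi> \<longleftrightarrow> uniform_positive_sequence_entropy G X \<phi> F"
proof -
  interpret abelian_action G X \<phi>
    using assms(1,5) unfolding G_system_def
    by (simp add: abelian_action_def abelian_action_axioms_def)
  show ?thesis
    using weakly_mixing_imp_upse[OF _ assms(4)] weakly_mixing_of_hits[OF upse_hits[OF _ assms(4)]]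
    by (rule iffI)
qed

end
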